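(* Let $T$ be an invertible bounded linear operator on a complex Hilbert space $\mathbb{H}$. If the sequence of Aluthge iterates $\Delta^{(n)}(T)$ converges in the operator norm, as $n\to\infty$, to an invertible hyperbolic operator on $\mathbb{H}$, then $T$ is hyperbolic.
   Context: - An invertible bounded linear operator $T$ is hyperbolic if $\sigma(T)\cap\mathbb{T}=\varnothing$, where $\sigma(T)$ is the spectrum and $\mathbb{T}=\{z\in\mathbb{C}:|z|=1\}$. - For $T\in B(\mathbb{H})$ let $T=U|T|$ be the polar decomposition, where $|T|=(T^*T)^{1/2}$ and $U$ is the unique partial isometry with $\ker U=\ker T=\ker|T|$. The Aluthge transform is $\Delta(T)=|T|^{1/2}U|T|^{1/2}$, and the Aluthge iterates are $\Delta^{(0)}(T)=T$, $\Delta^{(n)}(T)=\Delta(\Delta^{(n-1)}(T))$ for $n\ge1$. *)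

theory Defs
  imports "HOL-Analysis.Analysis"
begin

class complex_vector = real_vector +
  fixes scaleC :: "complex \<Rightarrow> 'a \<Rightarrow> 'a"  (infixr "*\<^sub>C" 75)
  assumes scaleC_add_right: "a *\<^sub>C (x + y) = a *\<^sub>C x + a *\<^sub>C y"
    and scaleC_add_left: "(a + b) *\<^sub>C x = a *\<^sub>C x + b *\<^sub>C x"
    and scaleC_scaleC: "a *\<^sub>C (b *\<^sub>C x) = (a * b) *\<^sub>C x"
    and scaleC_one: "1 *\<^sub>C x = x"
    and scaleR_scaleC: "r *\<^sub>R x = complex_of_real r *\<^sub>C x"

text \<open>The last axiom says that the norm is the one induced by the inner product. Together with
  the norm axioms it contains positive definiteness.\<close>

class complex_inner = complex_vector + real_normed_vector +
  fixes cinner :: "'a \<Rightarrow> 'a \<Rightarrow> complex"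
  assumes cinner_commute: "cinner y x = cnj (cinner x y)"
    and cinner_add_left: "cinner (x + y) z = cinner x z + cinner y z"
    and cinner_scaleC_left: "cinner (a *\<^sub>C x) y = a * cinner x y"
    and cinner_self: "cinner x x = complex_of_real ((norm x)\<^sup>2)"

class chilbert_space = complex_inner + complete_space

lemma norm_scaleC: "norm (a *\<^sub>C x) = cmod a * norm (x :: 'a :: complex_inner)"
proof -
  have "cinner (a *\<^sub>C x) (a *\<^sub>C x) = a * cnj a * cinner x x"
    using cinner_commute[of x "a *\<^sub>C x"] cinner_commute[of x x]
    by (simp add: cinner_scaleC_left)
  also have "a * cnj a = complex_of_real ((cmod a)\<^sup>2)"
    by (rule complex_norm_square[symmetric])
  finally have "complex_of_real ((norm (a *\<^sub>C x))\<^sup>2) = complex_of_real ((cmod a * norm x)\<^sup>2)"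
    by (simp add: cinner_self power_mult_distrib)
  then have "(norm (a *\<^sub>C x))\<^sup>2 = (cmod a * norm x)\<^sup>2"
    by (simp only: of_real_eq_iff)
  then show ?thesis
    by (simp add: power2_eq_iff_nonneg)
qed

instantiation complex :: chilbert_space
begin
definition scaleC_complex :: "complex \<Rightarrow> complex \<Rightarrow> complex" where "scaleC_complex a x = a * x"
definition cinner_complex :: "complex \<Rightarrow> complex \<Rightarrow> complex" where "cinner_complex x y = x * cnj y"
instance
  by standard
    (simp_all add: scaleC_complex_def cinner_complex_def algebra_simps scaleR_conv_of_real
      complex_norm_square[symmetric] flip: of_real_power)
end

text \<open>The library type of bounded linear maps consists of real-linear ones. It carries the
  operator norm and its topology; \<open>B(H)\<close> is the set of its complex-linear elements.\<close>

definition bounded_ops :: "('a :: chilbert_space \<Rightarrow>\<^sub>L 'a) set" where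
  "bounded_ops = {T. \<forall>c x. blinfun_apply T (c *\<^sub>C x) = c *\<^sub>C blinfun_apply T x}"

lift_definition scalar_op :: "complex \<Rightarrow> ('a :: chilbert_space \<Rightarrow>\<^sub>L 'a)" is "\<lambda>z x. z *\<^sub>C x"
proof -
  fix z :: complex
  show "bounded_linear (\<lambda>x :: 'a. z *\<^sub>C x)"
    by (rule bounded_linear_intro[where K = "cmod z"])
      (simp_all add: scaleC_add_right scaleR_scaleC scaleC_scaleC norm_scaleC mult.commute)
qed

definition invertible_op :: "('a :: chilbert_space \<Rightarrow>\<^sub>L 'a) \<Rightarrow> bool" where
  "invertible_op T \<longleftrightarrow> (\<exists>S\<in>bounded_ops. S o\<^sub>L T = id_blinfun \<and> T o\<^sub>L S = id_blinfun)"

definition spectrum :: "('a :: chilbert_space \<Rightarrow>\<^sub>L 'a) \<Rightarrow> complex set" where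
  "spectrum T = {z. \<not> invertible_op (T - scalar_op z)}"

definition hyperbolic :: "('a :: chilbert_space \<Rightarrow>\<^sub>L 'a) \<Rightarrow> bool" where
  "hyperbolic T \<longleftrightarrow>
     T \<in> bounded_ops \<and> invertible_op T \<and> spectrum T \<inter> {z. cmod z = 1} = {}"

definition adjoint_op :: "('a :: chilbert_space \<Rightarrow>\<^sub>L 'a) \<Rightarrow> ('a \<Rightarrow>\<^sub>L 'a)" where
  "adjoint_op T = (THE S. S \<in> bounded_ops \<and>
     (\<forall>x y. cinner (blinfun_apply T x) y = cinner x (blinfun_apply S y)))"

definition positive_op :: "('a :: chilbert_space \<Rightarrow>\<^sub>L 'a) \<Rightarrow> bool" where
  "positive_op A \<longleftrightarrow>
     A \<in> bounded_ops \<and> (\<forall>x. cinner (blinfun_apply A x) x \<in> \<real>\<^sub>\<ge>\<^sub>0)"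

definition sqrt_op :: "('a :: chilbert_space \<Rightarrow>\<^sub>L 'a) \<Rightarrow> ('a \<Rightarrow>\<^sub>L 'a)" where
  "sqrt_op A = (THE B. positive_op B \<and> B o\<^sub>L B = A)"

definition abs_op :: "('a :: chilbert_space \<Rightarrow>\<^sub>L 'a) \<Rightarrow> ('a \<Rightarrow>\<^sub>L 'a)" where
  "abs_op T = sqrt_op (adjoint_op T o\<^sub>L T)"

definition kernel :: "('a :: chilbert_space \<Rightarrow>\<^sub>L 'a) \<Rightarrow> 'a set" where
  "kernel T = {x. blinfun_apply T x = 0}"

definition partial_isometry :: "('a :: chilbert_space \<Rightarrow>\<^sub>L 'a) \<Rightarrow> bool" where
  "partial_isometry U \<longleftrightarrow> U \<in> bounded_ops \<and>
     (\<forall>x. (\<forall>y\<in>kernel U. cinner x y = 0) \<longrightarrow> norm (blinfun_apply U x) = norm x)"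

definition polar_factor :: "('a :: chilbert_space \<Rightarrow>\<^sub>L 'a) \<Rightarrow> ('a \<Rightarrow>\<^sub>L 'a)" where
  "polar_factor T = (THE U. partial_isometry U \<and> T = U o\<^sub>L abs_op T \<and>
     kernel U = kernel T \<and> kernel T = kernel (abs_op T))"

definition aluthge :: "('a :: chilbert_space \<Rightarrow>\<^sub>L 'a) \<Rightarrow> ('a \<Rightarrow>\<^sub>L 'a)" where
  "aluthge T = sqrt_op (abs_op T) o\<^sub>L polar_factor T o\<^sub>L sqrt_op (abs_op T)"

end

theory Submission
  imports Defs
begin

text \<open>For invertible \<open>T\<close> put \<open>R = |T|\<^sup>1\<^sup>/\<^sup>2\<close>. Then \<open>R\<close> is invertible and \<open>\<Delta>(T) = R U R = R T R\<^sup>-\<^sup>1\<close>, so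
  all Aluthge iterates are similar to \<open>T\<close>. If \<open>|z| = 1\<close>, then the iterates of \<open>T\<close> minus \<open>z\<close> converge to
  the invertible operator \<open>L - z\<close>; invertibility is an open condition, so one of them is invertible,
  and by similarity so is \<open>T - z\<close>. Since \<open>T\<^sup>* T\<close> and \<open>|T|\<close> are bounded below, their square roots come
  from a contraction.\<close>

text \<open>Makes the operators on the space a Banach space in the operator norm, so that closed
  sets of operators are complete and \<open>Banach_fix\<close> applies to them.\<close>

instance chilbert_space \<subseteq> banach ..

section \<open>Sesquilinearity and the Cauchy-Schwarz inequality\<close>

lemma cinner_add_right: "cinner x (y + z) = cinner x y + cinner (x :: 'a :: complex_inner) z"
  by (metis cinner_add_left cinner_commute complex_cnj_add)

lemma cinner_scaleC_right: "cinner x (a *\<^sub>C y) = cnj a * cinner (x :: 'a :: complex_inner) y"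
  by (metis cinner_scaleC_left cinner_commute complex_cnj_mult)

lemma cinner_scaleR_left: "cinner (r *\<^sub>R x) y = r *\<^sub>R cinner (x :: 'a :: complex_inner) y"
  by (simp add: scaleR_scaleC[of r x] cinner_scaleC_left scaleR_conv_of_real)

lemma cinner_scaleR_right: "cinner x (r *\<^sub>R y) = r *\<^sub>R cinner (x :: 'a :: complex_inner) y"
  by (simp add: scaleR_scaleC[of r y] cinner_scaleC_right scaleR_conv_of_real)

lemma Re_cinner_commute: "Re (cinner y x) = Re (cinner (x :: 'a :: complex_inner) y)"
  by (subst cinner_commute) simp

lemma norm_add_square:
  "(norm (x + y))\<^sup>2 = (norm x)\<^sup>2 + 2 * Re (cinner x y) + (norm (y :: 'a :: complex_inner))\<^sup>2"
proof -
  have "complex_of_real ((norm (x + y))\<^sup>2) = cinner x x + cinner x y + cinner y x + cinner y y"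
    unfolding cinner_self[symmetric] by (simp add: cinner_add_left cinner_add_right)
  from arg_cong[OF this, of Re] show ?thesis
    by (simp add: cinner_self Re_cinner_commute flip: of_real_power)
qed

text \<open>The triangle inequality is already a norm axiom of the class; squaring it and cancelling
  leaves the real form of Cauchy-Schwarz.\<close>

lemma Re_cinner_le: "Re (cinner x y) \<le> norm x * norm (y :: 'a :: complex_inner)"
proof -
  have "(norm (x + y))\<^sup>2 \<le> (norm x + norm y)\<^sup>2"
    by (intro power_mono norm_triangle_ineq) simp
  then show ?thesis
    unfolding norm_add_square by (simp add: power2_sum)
qed

text \<open>Multiplying \<open>x\<close> by a scalar of modulus 1 makes the inner product real and
  nonnegative without changing \<open>norm x\<close>, so the bound on real parts suffices.\<close>

lemma norm_cinner_le: "norm (cinner x y) \<le> norm x * norm (y :: 'a :: complex_inner)"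
proof (cases "cinner x y = 0")
  case False
  define a where "a = cnj (sgn (cinner x y))"
  have a: "cmod a = 1"
    using False by (simp add: a_def norm_sgn)
  have "cnj (cinner x y) * cinner x y = complex_of_real ((cmod (cinner x y))\<^sup>2)"
    by (subst mult.commute) (rule complex_norm_square[symmetric])
  then have "a * cinner x y = complex_of_real (cmod (cinner x y))"
    using False by (simp add: a_def sgn_eq power2_eq_square)
  then have "cmod (cinner x y) = Re (cinner (a *\<^sub>C x) y)"
    by (simp add: cinner_scaleC_left)
  also have "\<dots> \<le> norm x * norm y"
    using Re_cinner_le[of "a *\<^sub>C x" y] by (simp add: norm_scaleC a)
  finally show ?thesis .
qed simp

lemma bounded_bilinear_cinner: "bounded_bilinear (cinner :: 'a :: complex_inner \<Rightarrow> 'a \<Rightarrow> complex)"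
  by (rule bounded_bilinear.intro)
    (auto simp: cinner_add_left cinner_add_right cinner_scaleR_left cinner_scaleR_right
      intro!: exI[of _ 1] norm_cinner_le)

interpretation cinner: bounded_bilinear "cinner :: 'a :: complex_inner \<Rightarrow> 'a \<Rightarrow> complex"
  by (rule bounded_bilinear_cinner)

lemma scaleC_zero [simp]: "a *\<^sub>C (0 :: 'a :: complex_inner) = 0"
  by (metis mult_zero_right norm_eq_zero norm_scaleC)

lemma scaleC_diff_right: "a *\<^sub>C (x - y) = a *\<^sub>C x - a *\<^sub>C (y :: 'a :: complex_inner)"
  by (metis scaleC_add_right add_diff_cancel_right' diff_add_cancel)

lemma scaleC_scaleR_commute: "a *\<^sub>C (r *\<^sub>R x) = r *\<^sub>R (a *\<^sub>C (x :: 'a :: complex_inner))"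
  by (simp add: scaleR_scaleC scaleC_scaleC mult.commute)

lemma eq_of_cinner_left:
  assumes "\<And>x. cinner x y = cinner x (z :: 'a :: complex_inner)"
  shows "y = z"
proof -
  have "cinner (y - z) (y - z) = 0"
    using assms by (simp add: cinner.diff_right)
  then show ?thesis
    by (simp add: cinner_self)
qed

section \<open>Riesz representation and the adjoint\<close>

text \<open>The representing vector is the minimiser of \<open>\<phi> x = \<parallel>x\<parallel>\<^sup>2 - 2 f x\<close>, which by the parallelogram
  law is the limit of any minimising sequence.\<close>

lemma riesz_representation_real:
  fixes f :: "'a :: chilbert_space \<Rightarrow> real"
  assumes "bounded_linear f"
  shows "\<exists>y. \<forall>x. f x = Re (cinner x y)"
proof -
  interpret f: bounded_linear f by fact
  define \<phi> where "\<phi> x = (norm x)\<^sup>2 - 2 * f x" for x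
  define m where "m = Inf (range \<phi>)"
  obtain K where K: "\<And>x. norm (f x) \<le> norm x * K"
    using f.bounded by blast
  \<comment> \<open>Completing the square: \<open>norm x ^ 2 - 2 * K * norm x\<close> is at least
    \<open>- K ^ 2\<close>.\<close>
  have "- K\<^sup>2 \<le> \<phi> x" for x
  proof -
    have "f x \<le> norm x * K" using K[of x] by simp
    moreover have "0 \<le> (norm x - K)\<^sup>2" by simp
    ultimately show ?thesis
      unfolding \<phi>_def by (simp add: power2_diff)
  qed
  then have bdd: "bdd_below (range \<phi>)" by fast
  have m_le: "m \<le> \<phi> x" for x
    unfolding m_def by (intro cInf_lower bdd) auto
  have "\<exists>x. \<phi> x < m + inverse (real (Suc n))" for n
    using cInf_lessD[of "range \<phi>" "m + inverse (real (Suc n))"] by (auto simp: m_def)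
  then obtain X where X: "\<And>n. \<phi> (X n) < m + inverse (real (Suc n))" by metis
  \<comment> \<open>The midpoint of \<open>x\<close> and \<open>y\<close> has value at least
    \<open>m\<close>, so the parallelogram law turns two nearly minimal values into closeness of
    \<open>x\<close> and \<open>y\<close>.\<close>
  have par: "(norm (x - y))\<^sup>2 \<le> 2 * (\<phi> x - m) + 2 * (\<phi> y - m)" for x y
  proof -
    have "4 * \<phi> ((1/2) *\<^sub>R (x + y)) = (norm (x + y))\<^sup>2 - 4 * f x - 4 * f y"
      by (simp add: \<phi>_def f.scaleR f.add power_divide)
        (simp add: field_simps)
    moreover have "(norm (x + y))\<^sup>2 + (norm (x - y))\<^sup>2 = 2 * (norm x)\<^sup>2 + 2 * (norm y)\<^sup>2"
      using norm_add_square[of x y] norm_add_square[of x "-y"] by (simp add: cinner.minus_right)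
    moreover have "4 * m \<le> 4 * \<phi> ((1/2) *\<^sub>R (x + y))" using m_le by simp
    ultimately show ?thesis unfolding \<phi>_def by simp
  qed
  have "Cauchy X"
  proof (rule CauchyI)
    fix e :: real assume "0 < e"
    then obtain N where N: "inverse (real (Suc N)) < e\<^sup>2 / 4"
      using reals_Archimedean[of "e\<^sup>2 / 4"] by auto
    have small: "\<phi> (X n) - m < e\<^sup>2 / 4" if "n \<ge> N" for n
    proof -
      have "inverse (real (Suc n)) \<le> inverse (real (Suc N))" using that by simp
      with X[of n] N show ?thesis by linarith
    qed
    have "norm (X i - X j) < e" if "i \<ge> N" "j \<ge> N" for i j
    proof -
      have "(norm (X i - X j))\<^sup>2 < e\<^sup>2"
        using par[of "X i" "X j"] small[OF that(1)] small[OF that(2)]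
        by (simp add: field_simps)
      then show ?thesis using \<open>0 < e\<close> by (simp add: power_less_imp_less_base)
    qed
    then show "\<exists>M. \<forall>i\<ge>M. \<forall>j\<ge>M. norm (X i - X j) < e" by blast
  qed
  then obtain y where y: "X \<longlonglongrightarrow> y" using Cauchy_convergent convergent_def by blast
  have "(\<lambda>n. \<phi> (X n)) \<longlonglongrightarrow> \<phi> y"
    unfolding \<phi>_def by (intro tendsto_intros f.tendsto y)
  moreover have "(\<lambda>n. m + inverse (real (Suc n))) \<longlonglongrightarrow> m + 0"
    by (intro tendsto_intros LIMSEQ_inverse_real_of_nat)
  ultimately have "\<phi> y \<le> m + 0"
    using X by (intro LIMSEQ_le[where X = "\<lambda>n. \<phi> (X n)"]) (auto intro!: exI[of _ 0] less_imp_le)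
  then have min: "\<phi> y \<le> \<phi> x" for x using m_le[of x] by simp
  have "f x = Re (cinner x y)" for x
  proof (rule ccontr)
    define d where "d = f x - Re (cinner x y)"
    assume "f x \<noteq> Re (cinner x y)"
    then have d: "d \<noteq> 0" by (simp add: d_def)
    \<comment> \<open>Moving from \<open>y\<close> by \<open>t x\<close> changes \<phi> by
      \<open>- 2 t d + t^2 (norm x)^2\<close>; this choice of \<open>t\<close> makes the change
      \<open>- t^2 ((norm x)^2 + 2)\<close>. The added 1 keeps the denominator nonzero.\<close>
    define t where "t = d / ((norm x)\<^sup>2 + 1)"
    have "\<phi> (y + t *\<^sub>R x) = \<phi> y - 2 * t * d + t\<^sup>2 * (norm x)\<^sup>2"
      by (simp add: \<phi>_def norm_add_square f.add f.scaleR d_def cinner_scaleR_right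
          Re_cinner_commute[of y] power_mult_distrib algebra_simps)
    moreover have "2 * t * d = 2 * (t\<^sup>2 * ((norm x)\<^sup>2 + 1))"
    proof -
      have "(norm x)\<^sup>2 + 1 \<noteq> 0" by (simp add: add_nonneg_eq_0_iff)
      then have "d = t * ((norm x)\<^sup>2 + 1)" by (simp add: t_def)
      then show ?thesis by (simp add: power2_eq_square)
    qed
    moreover have "t\<^sup>2 > 0"
      using d by (simp add: t_def add_nonneg_eq_0_iff)
    moreover have "t\<^sup>2 * (norm x)\<^sup>2 \<ge> 0" by simp
    moreover have "t\<^sup>2 * ((norm x)\<^sup>2 + 1) = t\<^sup>2 * (norm x)\<^sup>2 + t\<^sup>2" by (simp add: distrib_left)
    ultimately have "\<phi> (y + t *\<^sub>R x) < \<phi> y" by linarith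
    with min[of "y + t *\<^sub>R x"] show False by simp
  qed
  then show ?thesis by blast
qed

text \<open>The real version represents the real part; evaluating at \<open>\<i> *\<^sub>C x\<close>
  recovers the imaginary part from it.\<close>

lemma riesz_representation:
  fixes f :: "'a :: chilbert_space \<Rightarrow> complex"
  assumes lin: "bounded_linear f" and C: "\<And>c x. f (c *\<^sub>C x) = c * f x"
  shows "\<exists>y. \<forall>x. f x = cinner x y"
proof -
  have "bounded_linear (\<lambda>x. Re (f x))"
    by (rule bounded_linear_compose[OF bounded_linear_Re lin])
  then obtain y where y: "\<And>x. Re (f x) = Re (cinner x y)"
    using riesz_representation_real by blast
  have "Im (f x) = Im (cinner x y)" for x
    using y[of "\<i> *\<^sub>C x"] by (simp add: C cinner_scaleC_left)
  then show ?thesis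
    using y by (auto simp: complex_eq_iff)
qed

lemma bounded_opsD: "T \<in> bounded_ops \<Longrightarrow> blinfun_apply T (c *\<^sub>C x) = c *\<^sub>C blinfun_apply T x"
  by (simp add: bounded_ops_def)

text \<open>Riesz representation, applied for each fixed \<open>y\<close>, yields the value
  \<open>s y\<close>. Linearity of \<open>s\<close> follows by testing against all vectors, and its
  bound by testing at \<open>x = s y\<close> and cancelling one factor
  \<open>norm (s y)\<close>.\<close>

lemma adjoint_op_exists:
  fixes T :: "'a :: chilbert_space \<Rightarrow>\<^sub>L 'a"
  assumes T: "T \<in> bounded_ops"
  shows "\<exists>S\<in>bounded_ops. \<forall>x y. cinner (T x) y = cinner x (blinfun_apply S y)"
proof -
  have "\<exists>z. \<forall>x. cinner (T x) y = cinner x z" for y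
    by (rule riesz_representation)
      (auto intro!: bounded_linear_intros bounded_linear_compose[OF cinner.bounded_linear_left]
        simp: bounded_opsD[OF T] cinner_scaleC_left)
  then obtain s where s: "\<And>x y. cinner (T x) y = cinner x (s y)" by metis
  have add: "s (x + y) = s x + s y" for x y
    by (rule eq_of_cinner_left) (simp add: s[symmetric] cinner_add_right)
  have sC: "s (c *\<^sub>C x) = c *\<^sub>C s x" for c x
    by (rule eq_of_cinner_left) (simp add: s[symmetric] cinner_scaleC_right)
  have "norm (s y) \<le> norm y * norm T" for y
  proof (cases "s y = 0")
    case False
    have "norm (s y) * norm (s y) = Re (cinner (T (s y)) y)"
      by (simp add: s cinner_self power2_eq_square)
    also have "\<dots> \<le> norm (T (s y)) * norm y" by (rule Re_cinner_le)
    also have "\<dots> \<le> (norm T * norm (s y)) * norm y"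
      by (intro mult_right_mono norm_blinfun) simp
    also have "\<dots> = norm (s y) * (norm y * norm T)" by (simp add: algebra_simps)
    finally show ?thesis using False by simp
  qed simp
  then have "bounded_linear s"
    by (intro bounded_linear_intro[where K = "norm T"]) (simp_all add: add sC scaleR_scaleC)
  then have "blinfun_apply (Blinfun s) = s" by (rule bounded_linear_Blinfun_apply)
  then show ?thesis
    using s sC by (intro bexI[of _ "Blinfun s"]) (simp_all add: bounded_ops_def)
qed

text \<open>\<open>adjoint_op\<close> is a definite description, so existence has to be paired with
  uniqueness, which comes from nondegeneracy of the inner product.\<close>

lemma adjoint_op:
  fixes T :: "'a :: chilbert_space \<Rightarrow>\<^sub>L 'a"
  assumes "T \<in> bounded_ops"
  shows adjoint_op_in_bounded_ops: "adjoint_op T \<in> bounded_ops"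
    and cinner_adjoint_op: "cinner (T x) y = cinner x (adjoint_op T y)"
proof -
  let ?P = "\<lambda>S. S \<in> bounded_ops \<and> (\<forall>x y. cinner (T x) y = cinner x (blinfun_apply S y))"
  have "\<exists>!S. ?P S"
  proof (rule ex_ex1I)
    show "\<exists>S. ?P S" using adjoint_op_exists[OF assms] by blast
    show "S = S'" if "?P S" "?P S'" for S S'
      using that by (intro blinfun_eqI, intro eq_of_cinner_left[where 'a = 'a]) metis
  qed
  from theI'[OF this] have "?P (adjoint_op T)" unfolding adjoint_op_def .
  then show "adjoint_op T \<in> bounded_ops" "cinner (T x) y = cinner x (adjoint_op T y)" by auto
qed

section \<open>Invertible operators\<close>

lemma blinfun_compose_assoc: "(S o\<^sub>L T) o\<^sub>L U = S o\<^sub>L (T o\<^sub>L U)"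
  by (rule blinfun_eqI) simp

lemma blinfun_compose_id [simp]: "T o\<^sub>L id_blinfun = T" "id_blinfun o\<^sub>L T = T"
  by (rule blinfun_eqI, simp)+

lemma left_inverse_apply: "S o\<^sub>L T = id_blinfun \<Longrightarrow> blinfun_apply S (T x) = x"
  by (metis blinfun_apply_blinfun_compose blinfun_apply_id_blinfun id_apply)

lemma compose_in_bounded_ops: "S \<in> bounded_ops \<Longrightarrow> T \<in> bounded_ops \<Longrightarrow> S o\<^sub>L T \<in> bounded_ops"
  by (simp add: bounded_ops_def)

lemma diff_in_bounded_ops: "S \<in> bounded_ops \<Longrightarrow> T \<in> bounded_ops \<Longrightarrow> S - T \<in> bounded_ops"
  by (simp add: bounded_ops_def blinfun.diff_left scaleC_diff_right)

text \<open>Written with \<open>scalar_op\<close>, complex homogeneity is a family of equations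
  between continuous functions of the operator. Closedness keeps limits of fixed-point iterations
  complex linear.\<close>

lemma closed_bounded_ops: "closed (bounded_ops :: ('a :: chilbert_space \<Rightarrow>\<^sub>L 'a) set)"
proof -
  have "bounded_ops = {T :: 'a \<Rightarrow>\<^sub>L 'a. \<forall>c x. T (scalar_op c x) = scalar_op c (T x)}"
    by (simp add: bounded_ops_def scalar_op.rep_eq)
  moreover have "closed \<dots>"
    by (intro closed_Collect_all closed_Collect_eq continuous_intros)
  ultimately show ?thesis by simp
qed

lemma invertible_op_compose:
  assumes "invertible_op S" "invertible_op T"
  shows "invertible_op (S o\<^sub>L T)"
proof -
  obtain S' T' where "S' \<in> bounded_ops" "S' o\<^sub>L S = id_blinfun" "S o\<^sub>L S' = id_blinfun"
    "T' \<in> bounded_ops" "T' o\<^sub>L T = id_blinfun" "T o\<^sub>L T' = id_blinfun"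
    using assms unfolding invertible_op_def by blast
  then show ?thesis
    unfolding invertible_op_def
    by (intro bexI[of _ "T' o\<^sub>L S'"] conjI blinfun_eqI compose_in_bounded_ops)
      (simp_all add: left_inverse_apply)
qed

text \<open>The one-sided inverses coincide, \<open>S = S T S' = S'\<close>, so complex linearity of
  \<open>S\<close> carries over to \<open>S'\<close>.\<close>

lemma invertible_op_of_left_right_inverse:
  assumes "S \<in> bounded_ops" "S o\<^sub>L T = id_blinfun" "T o\<^sub>L S' = id_blinfun"
  shows "invertible_op T"
proof -
  have "S = S'"
    using assms by (metis blinfun_compose_assoc blinfun_compose_id)
  with assms show ?thesis unfolding invertible_op_def by blast
qed

text \<open>If \<open>S\<close> inverts \<open>R R\<close>, then \<open>S R\<close> is a left
  inverse and \<open>R S\<close> a right inverse of \<open>R\<close>.\<close>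

lemma invertible_op_of_square:
  assumes "R \<in> bounded_ops" "invertible_op (R o\<^sub>L R)"
  shows "invertible_op R"
proof -
  obtain S where S: "S \<in> bounded_ops" "S o\<^sub>L (R o\<^sub>L R) = id_blinfun" "(R o\<^sub>L R) o\<^sub>L S = id_blinfun"
    using assms(2) unfolding invertible_op_def by blast
  show ?thesis
    by (rule invertible_op_of_left_right_inverse[of "S o\<^sub>L R" _ "R o\<^sub>L S"])
      (use S assms(1) in \<open>simp_all add: compose_in_bounded_ops blinfun_compose_assoc\<close>)
qed

lemma kernel_invertible_op: "invertible_op S \<Longrightarrow> kernel S = {0}"
  unfolding invertible_op_def kernel_def
  by (auto simp: blinfun.zero_right)
    (metis blinfun.zero_right left_inverse_apply)

text \<open>With \<open>S = L\<^sup>-\<^sup>1\<close> and \<open>D = N - L\<close>, the two one-sided inverses of \<open>N\<close> are the fixed points of the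
  contractions \<open>X \<mapsto> S - S D X\<close> and \<open>X \<mapsto> S - X D S\<close>.\<close>

lemma invertible_op_perturbation:
  fixes L N S :: "'a :: chilbert_space \<Rightarrow>\<^sub>L 'a"
  assumes N: "N \<in> bounded_ops" and L: "L \<in> bounded_ops" and S: "S \<in> bounded_ops"
    and SL: "S o\<^sub>L L = id_blinfun" and LS: "L o\<^sub>L S = id_blinfun"
    and small: "norm S * norm (N - L) < 1"
  shows "invertible_op N"
proof -
  define D where "D = N - L"
  have D: "D \<in> bounded_ops" using N L by (simp add: D_def diff_in_bounded_ops)
  have SLx: "S (L x) = x" and LSx: "L (S x) = x" for x
    using SL LS by (simp_all add: left_inverse_apply)
  have complete: "complete (bounded_ops :: ('a \<Rightarrow>\<^sub>L 'a) set)"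
    by (simp add: complete_eq_closed closed_bounded_ops)
  note b = compose_in_bounded_ops diff_in_bounded_ops S D
  have "\<exists>!X\<in>bounded_ops. S - (S o\<^sub>L (D o\<^sub>L X)) = X"
  proof (rule Banach_fix[OF complete, where c = "norm S * norm D"])
    show "dist (S - (S o\<^sub>L (D o\<^sub>L X))) (S - (S o\<^sub>L (D o\<^sub>L Y))) \<le> norm S * norm D * dist X Y"
      for X Y :: "'a \<Rightarrow>\<^sub>L 'a"
    proof -
      have "(S - (S o\<^sub>L (D o\<^sub>L X))) - (S - (S o\<^sub>L (D o\<^sub>L Y))) = S o\<^sub>L (D o\<^sub>L (Y - X))"
        by (rule blinfun_eqI) (simp add: blinfun.bilinear_simps)
      then have "dist (S - (S o\<^sub>L (D o\<^sub>L X))) (S - (S o\<^sub>L (D o\<^sub>L Y))) = norm (S o\<^sub>L (D o\<^sub>L (Y - X)))"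
        by (simp add: dist_norm)
      also have "\<dots> \<le> norm S * (norm D * norm (Y - X))"
        by (meson mult_left_mono norm_blinfun_compose norm_ge_zero order_trans)
      finally show "dist (S - (S o\<^sub>L (D o\<^sub>L X))) (S - (S o\<^sub>L (D o\<^sub>L Y))) \<le> norm S * norm D * dist X Y"
        by (simp add: dist_norm norm_minus_commute mult.assoc)
    qed
  qed (use small[folded D_def] S D in \<open>auto intro!: diff_in_bounded_ops compose_in_bounded_ops\<close>)
  then obtain X where "X \<in> bounded_ops" and X: "S - (S o\<^sub>L (D o\<^sub>L X)) = X" by blast
  have "\<exists>!X\<in>bounded_ops. S - (X o\<^sub>L (D o\<^sub>L S)) = X"
  proof (rule Banach_fix[OF complete, where c = "norm S * norm D"])
    show "dist (S - (X o\<^sub>L (D o\<^sub>L S))) (S - (Y o\<^sub>L (D o\<^sub>L S))) \<le> norm S * norm D * dist X Y"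
      for X Y :: "'a \<Rightarrow>\<^sub>L 'a"
    proof -
      have "(S - (X o\<^sub>L (D o\<^sub>L S))) - (S - (Y o\<^sub>L (D o\<^sub>L S))) = (Y - X) o\<^sub>L (D o\<^sub>L S)"
        by (rule blinfun_eqI) (simp add: blinfun.bilinear_simps)
      then have "dist (S - (X o\<^sub>L (D o\<^sub>L S))) (S - (Y o\<^sub>L (D o\<^sub>L S))) = norm ((Y - X) o\<^sub>L (D o\<^sub>L S))"
        by (simp add: dist_norm)
      also have "\<dots> \<le> norm (Y - X) * (norm D * norm S)"
        by (meson mult_left_mono norm_blinfun_compose norm_ge_zero order_trans)
      finally show "dist (S - (X o\<^sub>L (D o\<^sub>L S))) (S - (Y o\<^sub>L (D o\<^sub>L S))) \<le> norm S * norm D * dist X Y"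
        by (simp add: dist_norm norm_minus_commute ac_simps)
    qed
  qed (use small[folded D_def] S D in \<open>auto intro!: diff_in_bounded_ops compose_in_bounded_ops\<close>)
  then obtain X' where X'b: "X' \<in> bounded_ops" and X': "S - (X' o\<^sub>L (D o\<^sub>L S)) = X'" by blast
  have Nx: "N x = L x + D x" for x by (simp add: D_def blinfun.diff_left)
  have Xx: "X x = S x - S (D (X x))" for x
    using arg_cong[OF X, of "\<lambda>F. blinfun_apply F x"] by (simp add: blinfun.diff_left)
  have X'x: "X' x = S x - X' (D (S x))" for x
    using arg_cong[OF X', of "\<lambda>F. blinfun_apply F x"] by (simp add: blinfun.diff_left)
  show ?thesis
  \<comment> \<open>Composed with \<open>L\<close>, the fixed-point equations read
    \<open>X' L = I - X' D\<close> and \<open>L X = I - D X\<close>; adding the terms with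
    \<open>D\<close> gives \<open>X' N = I\<close> and \<open>N X = I\<close>.\<close>
  proof (rule invertible_op_of_left_right_inverse[OF X'b, of _ X])
    show "X' o\<^sub>L N = id_blinfun"
      by (rule blinfun_eqI) (simp add: Nx blinfun.add_right X'x[of "L _"] SLx)
    show "N o\<^sub>L X = id_blinfun"
    proof (rule blinfun_eqI)
      fix x
      have "L (X x) = x - D (X x)"
        by (subst Xx) (simp add: blinfun.diff_right LSx)
      then show "(N o\<^sub>L X) x = id_blinfun x" by (simp add: Nx)
    qed
  qed
qed

lemma invertible_op_of_limit:
  fixes F :: "nat \<Rightarrow> 'a :: chilbert_space \<Rightarrow>\<^sub>L 'a"
  assumes F: "\<And>n. F n \<in> bounded_ops" and L: "L \<in> bounded_ops" "invertible_op L"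
    and lim: "F \<longlonglongrightarrow> L"
  shows "\<exists>n. invertible_op (F n)"
proof -
  obtain S where S: "S \<in> bounded_ops" "S o\<^sub>L L = id_blinfun" "L o\<^sub>L S = id_blinfun"
    using L(2) unfolding invertible_op_def by blast
  have "(\<lambda>n. norm S * norm (F n - L)) \<longlonglongrightarrow> norm S * norm (L - L)"
    by (intro tendsto_intros lim)
  then have "\<forall>\<^sub>F n in sequentially. norm S * norm (F n - L) < 1"
    by (rule order_tendstoD) simp
  then obtain n where "norm S * norm (F n - L) < 1"
    by (meson eventually_happens' trivial_limit_sequentially)
  then show ?thesis
    using invertible_op_perturbation[OF F L(1) S] by blast
qed

section \<open>Square roots of strictly positive operators\<close>

text \<open>The uniform constant \<open>c\<close> is what makes \<open>I - t A\<close> a strict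
  contraction for a suitable \<open>t\<close>. Self-adjointness is stated through the form, without
  the description behind \<open>adjoint_op\<close>.\<close>

definition strictly_positive_op :: "('a :: chilbert_space \<Rightarrow>\<^sub>L 'a) \<Rightarrow> bool" where
  "strictly_positive_op A \<longleftrightarrow> A \<in> bounded_ops \<and> (\<forall>x y. cinner (A x) y = cinner x (A y)) \<and>
     (\<exists>c>0. \<forall>x. c * (norm x)\<^sup>2 \<le> Re (cinner (A x) x))"

lemma strictly_positive_imp_positive_op:
  assumes "strictly_positive_op A"
  shows "positive_op A"
proof -
  have "cinner (A x) x \<in> \<real>\<^sub>\<ge>\<^sub>0" for x
  proof -
    have "cinner (A x) x = cnj (cinner (A x) x)"
      using assms cinner_commute[of "A x" x] by (simp add: strictly_positive_op_def)
    then have "Im (cinner (A x) x) = 0" by (simp add: complex_eq_iff)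
    moreover obtain c where "c > 0" "c * (norm x)\<^sup>2 \<le> Re (cinner (A x) x)"
      using assms by (auto simp: strictly_positive_op_def)
    then have "0 \<le> Re (cinner (A x) x)"
      by (meson less_imp_le mult_nonneg_nonneg order_trans zero_le_power2)
    ultimately show ?thesis by (simp add: complex_nonneg_Reals_iff)
  qed
  with assms show ?thesis by (simp add: positive_op_def strictly_positive_op_def)
qed

text \<open>Expanding the square bounds \<open>norm (x - t A x) ^ 2\<close> by
  \<open>(1 - 2 t c + t^2 M^2) (norm x)^2\<close>; the factor is least at
  \<open>t = c / M^2\<close>, where it equals \<open>1 - (c / M)^2\<close>.\<close>

lemma strictly_positive_op_contraction:
  assumes "strictly_positive_op A"
  obtains t b where "0 < t" "0 \<le> b" "b < 1" "norm (id_blinfun - t *\<^sub>R A) \<le> b"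
proof -
  obtain c where c: "c > 0" "\<And>x. c * (norm x)\<^sup>2 \<le> Re (cinner (A x) x)"
    using assms by (auto simp: strictly_positive_op_def)
  \<comment> \<open>\<open>M\<close> dominates \<open>norm A\<close> for the estimate of
    \<open>A x\<close>, and \<open>c\<close> so that the square root defining \<open>b\<close> has a
    nonnegative argument, even on the zero space.\<close>
  define M where "M = norm A + c"
  have M: "norm A \<le> M" "c \<le> M" "0 < M" using c(1) by (auto simp: M_def add_nonneg_pos)
  define t where "t = c / M\<^sup>2"
  define b where "b = sqrt (1 - (c / M)\<^sup>2)"
  have cM: "0 < c / M" "c / M \<le> 1" using c(1) M by auto
  then have cM2: "0 < (c / M)\<^sup>2" "(c / M)\<^sup>2 \<le> 1" by (auto simp: power_le_one)
  show ?thesis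
  proof (rule that[of t b])
    show "0 < t" using c(1) M by (simp add: t_def)
    show "0 \<le> b" "b < 1" using cM2 by (auto simp: b_def)
    show "norm (id_blinfun - t *\<^sub>R A) \<le> b"
    proof (rule norm_blinfun_bound)
      fix x
      have "norm (A x) \<le> M * norm x"
        using norm_blinfun[of A x] M(1) by (meson mult_right_mono norm_ge_zero order_trans)
      then have Ax: "(norm (A x))\<^sup>2 \<le> M\<^sup>2 * (norm x)\<^sup>2"
        by (metis norm_ge_zero power_mono power_mult_distrib)
      have "(norm (x - t *\<^sub>R A x))\<^sup>2 = (norm x)\<^sup>2 - 2 * t * Re (cinner (A x) x) + t\<^sup>2 * (norm (A x))\<^sup>2"
        using norm_add_square[of x "- (t *\<^sub>R A x)"]
        by (simp add: cinner.minus_right cinner_scaleR_right Re_cinner_commute[of x] power_mult_distrib)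
      also have "\<dots> \<le> (norm x)\<^sup>2 - 2 * t * (c * (norm x)\<^sup>2) + t\<^sup>2 * (M\<^sup>2 * (norm x)\<^sup>2)"
        using \<open>0 < t\<close> c(2)[of x] Ax
        by (intro add_mono diff_mono mult_left_mono) auto
      also have "\<dots> = (1 - (c / M)\<^sup>2) * (norm x)\<^sup>2"
        using M(3) by (simp add: t_def field_simps power2_eq_square)
      also have "\<dots> = (b * norm x)\<^sup>2"
        using cM2 by (simp add: b_def power_mult_distrib)
      finally have "norm (x - t *\<^sub>R A x) \<le> b * norm x"
        by (rule power2_le_imp_le) (simp add: \<open>0 \<le> b\<close>)
      then show "norm ((id_blinfun - t *\<^sub>R A) x) \<le> b * norm x"
        by (simp add: blinfun.bilinear_simps)
    qed (use \<open>0 \<le> b\<close> in auto)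
  qed
qed

text \<open>If \<open>\<parallel>I - t A\<parallel> < 1\<close>, then \<open>Y \<mapsto> (I - t A + Y\<^sup>2) / 2\<close> is a contraction of a ball of radius less
  than 1; a fixed point satisfies \<open>(I - Y)\<^sup>2 = t A\<close>.\<close>

lemma strictly_positive_op_sqrt_exists:
  fixes A :: "'a :: chilbert_space \<Rightarrow>\<^sub>L 'a"
  assumes A: "strictly_positive_op A"
  obtains P where "strictly_positive_op P" "P o\<^sub>L P = A"
    "\<And>C. C o\<^sub>L A = A o\<^sub>L C \<Longrightarrow> C o\<^sub>L P = P o\<^sub>L C"
proof -
  obtain t b where t: "0 < t" and b: "0 \<le> b" "b < 1" and bn: "norm (id_blinfun - t *\<^sub>R A) \<le> b"
    using strictly_positive_op_contraction[OF A] by metis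
  have Ab: "A \<in> bounded_ops" and Ah: "\<And>x y. cinner (A x) y = cinner x (A y)"
    using A by (auto simp: strictly_positive_op_def)
  define herm where "herm = {Y :: 'a \<Rightarrow>\<^sub>L 'a. \<forall>x y. cinner (Y x) y = cinner x (Y y)}"
  \<comment> \<open>The operators commuting with everything that commutes with \<open>A\<close>.
    Keeping the iteration in this set gives the root the commutation property on which its
    uniqueness rests.\<close>
  define comm where "comm = {Y :: 'a \<Rightarrow>\<^sub>L 'a. \<forall>C. C o\<^sub>L A = A o\<^sub>L C \<longrightarrow> (\<forall>x. C (Y x) = Y (C x))}"
  define K where "K = bounded_ops \<inter> herm \<inter> comm \<inter> cball 0 b"
  define f where "f Y = (1/2) *\<^sub>R ((id_blinfun - t *\<^sub>R A) + (Y o\<^sub>L Y))" for Y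
  have fx: "f Y x = (1/2) *\<^sub>R ((x - t *\<^sub>R A x) + Y (Y x))" for Y x
    by (simp add: f_def blinfun.bilinear_simps)
  have "\<exists>!Y\<in>K. f Y = Y"
  proof (rule Banach_fix[of K b f])
    have "closed herm" unfolding herm_def
      by (intro closed_Collect_all closed_Collect_eq cinner.continuous_on continuous_intros)
    moreover have "closed comm" unfolding comm_def
      by (intro closed_Collect_all closed_Collect_imp closed_Collect_eq continuous_intros) simp
    ultimately show "complete K"
      unfolding K_def complete_eq_closed
      by (intro closed_Int closed_bounded_ops closed_cball)
    have "0 \<in> K"
      using b by (simp add: K_def bounded_ops_def herm_def comm_def blinfun.zero_right
          cinner.zero_left cinner.zero_right)
    then show "K \<noteq> {}" by blast
    show "f ` K \<subseteq> K"
    proof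
      fix Z assume "Z \<in> f ` K"
      then obtain Y where Y: "Y \<in> K" and Z: "Z = f Y" by blast
      have "f Y \<in> bounded_ops"
        using Y Ab by (simp add: K_def bounded_ops_def fx scaleC_scaleR_commute scaleC_add_right
            scaleC_diff_right)
      moreover have "f Y \<in> herm"
        using Y Ah by (simp add: K_def herm_def fx cinner.add_left cinner.add_right cinner.diff_left
            cinner.diff_right cinner_scaleR_left cinner_scaleR_right)
      moreover have "f Y \<in> comm"
        unfolding comm_def
      proof (clarify)
        fix C x assume C: "C o\<^sub>L A = A o\<^sub>L C"
        then have "C (A x) = A (C x)" for x
          by (metis blinfun_apply_blinfun_compose)
        moreover have "C (Y x) = Y (C x)" for x
          using Y C by (simp add: K_def comm_def)
        ultimately show "C (f Y x) = f Y (C x)"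
          by (simp add: fx blinfun.add_right blinfun.diff_right blinfun.scaleR_right)
      qed
      moreover have "norm (f Y) \<le> b"
      proof -
        have Yb: "norm Y \<le> b" using Y by (simp add: K_def)
        \<comment> \<open>Since \<open>b < 1\<close>, the square has norm at most \<open>b\<close>,
          and half of \<open>b + b\<close> stays in the ball.\<close>
        have "norm (Y o\<^sub>L Y) \<le> norm Y * norm Y" by (rule norm_blinfun_compose)
        also have "\<dots> \<le> b * 1" using Yb b by (intro mult_mono) auto
        finally have "norm ((id_blinfun - t *\<^sub>R A) + (Y o\<^sub>L Y)) \<le> b + b"
          using bn by (intro norm_triangle_mono) auto
        then show ?thesis by (simp add: f_def)
      qed
      ultimately show "Z \<in> K" by (simp add: K_def Z)
    qed
    show "dist (f Y) (f Z) \<le> b * dist Y Z" if "Y \<in> K" "Z \<in> K" for Y Z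
    proof -
      have YZ: "norm Y \<le> b" "norm Z \<le> b" using that by (auto simp: K_def)
      \<comment> \<open>\<open>Y Y - Z Z\<close> splits as \<open>Y (Y - Z) + (Y - Z) Z\<close>
        without commutativity; each summand has norm at most
        \<open>b * norm (Y - Z)\<close>.\<close>
      have "f Y - f Z = (1/2) *\<^sub>R ((Y o\<^sub>L (Y - Z)) + ((Y - Z) o\<^sub>L Z))"
        by (rule blinfun_eqI)
          (simp add: fx blinfun.diff_left blinfun.add_left blinfun.scaleR_left blinfun.diff_right
            algebra_simps)
      then have "dist (f Y) (f Z) = (1/2) * norm ((Y o\<^sub>L (Y - Z)) + ((Y - Z) o\<^sub>L Z))"
        by (simp add: dist_norm)
      also have "norm ((Y o\<^sub>L (Y - Z)) + ((Y - Z) o\<^sub>L Z)) \<le> b * norm (Y - Z) + norm (Y - Z) * b"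
        by (intro norm_triangle_mono order_trans[OF norm_blinfun_compose] mult_mono YZ b) auto
      finally show "dist (f Y) (f Z) \<le> b * dist Y Z" by (simp add: dist_norm)
    qed
  qed (use b in auto)
  then obtain Y where Y: "Y \<in> K" and fp: "f Y = Y" by blast
  have YY: "Y (Y x) = 2 *\<^sub>R Y x - x + t *\<^sub>R A x" for x
  proof -
    have "2 *\<^sub>R Y x = 2 *\<^sub>R f Y x" by (simp add: fp)
    then show ?thesis by (simp add: fx)
  qed
  \<comment> \<open>Rescales the root \<open>I - Y\<close> of \<open>t A\<close>; as
    \<open>norm Y\<close> is at most \<open>b\<close>, it is bounded below by
    \<open>(1 - b) / sqrt t\<close>.\<close>
  define P where "P = (1 / sqrt t) *\<^sub>R (id_blinfun - Y)"
  have Px: "P x = (1 / sqrt t) *\<^sub>R (x - Y x)" for x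
    by (simp add: P_def blinfun.bilinear_simps)
  show ?thesis
  proof (rule that[of P])
    have "P \<in> bounded_ops"
      using Y by (simp add: K_def bounded_ops_def Px scaleC_scaleR_commute scaleC_diff_right)
    moreover have "cinner (P x) y = cinner x (P y)" for x y
      using Y by (simp add: K_def herm_def Px cinner.diff_left cinner.diff_right
          cinner_scaleR_left cinner_scaleR_right)
    moreover have "(1 - b) / sqrt t * (norm x)\<^sup>2 \<le> Re (cinner (P x) x)" for x
    proof -
      have "Re (cinner (Y x) x) \<le> norm (Y x) * norm x" by (rule Re_cinner_le)
      also have "\<dots> \<le> (norm Y * norm x) * norm x" by (intro mult_right_mono norm_blinfun) auto
      also have "\<dots> \<le> (b * norm x) * norm x"
        using Y by (intro mult_right_mono) (auto simp: K_def)
      finally have "(1 - b) * (norm x)\<^sup>2 \<le> Re (cinner (x - Y x) x)"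
        by (simp add: cinner.diff_left cinner_self power2_eq_square algebra_simps)
      then show ?thesis
        using t by (simp add: Px cinner_scaleR_left divide_right_mono)
    qed
    moreover have "(1 - b) / sqrt t > 0" using t b by simp
    ultimately show "strictly_positive_op P" unfolding strictly_positive_op_def by blast
    show "P o\<^sub>L P = A"
    proof (rule blinfun_eqI)
      fix x
      have "P (P x) = (1 / t) *\<^sub>R ((x - Y x) - Y (x - Y x))"
        using t by (simp add: Px blinfun.scaleR_right flip: scaleR_diff_right)
      also have "(x - Y x) - Y (x - Y x) = t *\<^sub>R A x"
        by (simp add: blinfun.diff_right YY algebra_simps scaleR_2)
      finally show "(P o\<^sub>L P) x = A x" using t by simp
    qed
    show "C o\<^sub>L P = P o\<^sub>L C" if "C o\<^sub>L A = A o\<^sub>L C" for C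
      using Y that by (intro blinfun_eqI)
        (simp add: K_def comm_def Px blinfun.diff_right blinfun.scaleR_right)
  qed
qed

text \<open>The description in \<open>sqrt_op\<close> requires uniqueness among all positive roots.
  Another root \<open>Q\<close> commutes with \<open>A = Q Q\<close>, hence with \<open>P\<close>,
  so \<open>d = Q x - P x\<close> satisfies \<open>(P + Q) d = 0\<close>; positivity of
  \<open>Q\<close> and the lower bound for \<open>P\<close> force \<open>d = 0\<close>.\<close>

lemma sqrt_op_strictly_positive:
  fixes A :: "'a :: chilbert_space \<Rightarrow>\<^sub>L 'a"
  assumes A: "strictly_positive_op A"
  shows strictly_positive_sqrt_op: "strictly_positive_op (sqrt_op A)"
    and sqrt_op_square: "sqrt_op A o\<^sub>L sqrt_op A = A"
proof -
  obtain P where P: "strictly_positive_op P" "P o\<^sub>L P = A"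
    and comm: "\<And>C. C o\<^sub>L A = A o\<^sub>L C \<Longrightarrow> C o\<^sub>L P = P o\<^sub>L C"
    using strictly_positive_op_sqrt_exists[OF A] by metis
  obtain c where c: "c > 0" "\<And>x. c * (norm x)\<^sup>2 \<le> Re (cinner (P x) x)"
    using P(1) by (auto simp: strictly_positive_op_def)
  have "Q = P" if Q: "positive_op Q" "Q o\<^sub>L Q = A" for Q
  proof (rule blinfun_eqI)
    fix x
    have "Q o\<^sub>L A = A o\<^sub>L Q" by (simp add: blinfun_compose_assoc flip: Q(2))
    then have QP: "Q (P x) = P (Q x)" for x
      using comm by (metis blinfun_apply_blinfun_compose)
    define d where "d = Q x - P x"
    have "Q (Q x) = P (P x)"
      using P(2) Q(2) by (metis blinfun_apply_blinfun_compose)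
    then have "P d + Q d = 0"
      by (simp add: d_def blinfun.diff_right QP)
    then have "Re (cinner (P d) d) + Re (cinner (Q d) d) = 0"
      by (metis cinner.add_left cinner.zero_left plus_complex.sel(1) zero_complex.sel(1))
    moreover have "0 \<le> Re (cinner (Q d) d)"
      using Q(1) by (simp add: positive_op_def complex_nonneg_Reals_iff)
    ultimately have "c * (norm d)\<^sup>2 \<le> 0" using c(2)[of d] by linarith
    then have "d = 0" using c(1) by (simp add: mult_le_0_iff)
    then show "Q x = P x" by (simp add: d_def)
  qed
  then have "sqrt_op A = P"
    unfolding sqrt_op_def using P strictly_positive_imp_positive_op by (intro the_equality) auto
  with P show "strictly_positive_op (sqrt_op A)" "sqrt_op A o\<^sub>L sqrt_op A = A" by auto
qed

lemma invertible_sqrt_op: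
  assumes "strictly_positive_op A" "invertible_op A"
  shows "invertible_op (sqrt_op A)"
  using assms strictly_positive_sqrt_op[OF assms(1)] sqrt_op_square[OF assms(1)]
  by (intro invertible_op_of_square[of "sqrt_op A"]) (auto simp: strictly_positive_op_def)

section \<open>The Aluthge transform of an invertible operator\<close>

context
  fixes T :: "'a :: chilbert_space \<Rightarrow>\<^sub>L 'a"
  assumes T: "T \<in> bounded_ops" and inv: "invertible_op T"
begin

text \<open>The quadratic form is \<open>norm (T x) ^ 2\<close>, and an inverse \<open>S\<close> of
  \<open>T\<close> bounds it below through \<open>norm x\<close> \<le>
  \<open>norm S * norm (T x)\<close>.\<close>

lemma adjoint_compose_strictly_positive: "strictly_positive_op (adjoint_op T o\<^sub>L T)"
  unfolding strictly_positive_op_def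
proof (intro conjI allI)
  show "adjoint_op T o\<^sub>L T \<in> bounded_ops"
    using T by (simp add: compose_in_bounded_ops adjoint_op_in_bounded_ops)
  have left: "cinner (adjoint_op T x) y = cinner x (T y)" for x y
    using cinner_adjoint_op[OF T, of y x] by (metis cinner_commute)
  show "cinner ((adjoint_op T o\<^sub>L T) x) y = cinner x ((adjoint_op T o\<^sub>L T) y)" for x y
    by (simp add: left cinner_adjoint_op[OF T, symmetric])
  obtain S where S: "S o\<^sub>L T = id_blinfun" using inv unfolding invertible_op_def by blast
  \<comment> \<open>The added 1 makes \<open>k\<close> positive even if \<open>norm S = 0\<close>,
    as on the zero space.\<close>
  define k where "k = norm S + 1"
  have k: "k > 0" by (simp add: k_def add_nonneg_pos)
  have "(1 / k\<^sup>2) * (norm x)\<^sup>2 \<le> Re (cinner ((adjoint_op T o\<^sub>L T) x) x)" for x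
  proof -
    have "norm x = norm (S (T x))"
      using S by (simp add: left_inverse_apply)
    also have "\<dots> \<le> norm S * norm (T x)" by (rule norm_blinfun)
    also have "\<dots> \<le> k * norm (T x)" by (intro mult_right_mono) (auto simp: k_def)
    finally have "(norm x)\<^sup>2 \<le> k\<^sup>2 * (norm (T x))\<^sup>2"
      by (metis norm_ge_zero power_mono power_mult_distrib)
    then show ?thesis
      using k by (simp add: left cinner_self field_simps flip: of_real_power)
  qed
  then show "\<exists>c>0. \<forall>x. c * (norm x)\<^sup>2 \<le> Re (cinner ((adjoint_op T o\<^sub>L T) x) x)"
    using k by (intro exI[of _ "1 / k\<^sup>2"]) auto
qed

lemma invertible_adjoint_op: "invertible_op (adjoint_op T)"
proof -
  obtain S where S: "S \<in> bounded_ops" "S o\<^sub>L T = id_blinfun" "T o\<^sub>L S = id_blinfun"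
    using inv unfolding invertible_op_def by blast
  then have ST: "S (T x) = x" and TS: "T (S x) = x" for x
    by (simp_all add: left_inverse_apply)
  have "adjoint_op S o\<^sub>L adjoint_op T = id_blinfun" "adjoint_op T o\<^sub>L adjoint_op S = id_blinfun"
    by (rule blinfun_eqI, rule eq_of_cinner_left,
        simp add: ST TS cinner_adjoint_op[OF T, symmetric] cinner_adjoint_op[OF S(1), symmetric])+
  then show ?thesis
    using adjoint_op_in_bounded_ops[OF S(1)] unfolding invertible_op_def by blast
qed

lemma strictly_positive_abs_op: "strictly_positive_op (abs_op T)"
  unfolding abs_op_def by (intro strictly_positive_sqrt_op adjoint_compose_strictly_positive)

lemma invertible_abs_op: "invertible_op (abs_op T)"
  unfolding abs_op_def
  by (intro invertible_sqrt_op adjoint_compose_strictly_positive invertible_op_compose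
      invertible_adjoint_op inv)

text \<open>Moving one factor of \<open>abs_op T\<close> across the inner product produces its
  square, which is \<open>adjoint_op T o\<^sub>L T\<close>. This makes \<open>T\<close> composed
  with the inverse of \<open>abs_op T\<close> isometric.\<close>

lemma norm_abs_op: "norm (abs_op T x) = norm (T x)"
proof -
  have "cinner (abs_op T x) (abs_op T x) = cinner x ((abs_op T o\<^sub>L abs_op T) x)"
    using strictly_positive_abs_op by (simp add: strictly_positive_op_def)
  also have "\<dots> = cinner (T x) (T x)"
    unfolding abs_op_def
    by (simp add: sqrt_op_square[OF adjoint_compose_strictly_positive] cinner_adjoint_op[OF T])
  finally have "(norm (abs_op T x))\<^sup>2 = (norm (T x))\<^sup>2"
    unfolding cinner_self of_real_eq_iff .
  then show ?thesis by (simp add: power2_eq_iff_nonneg)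
qed

text \<open>With \<open>V\<close> inverse to \<open>abs_op T\<close>, the factor is
  \<open>T V\<close>: it is isometric, all kernels are zero because all operators involved are
  invertible, and cancelling \<open>abs_op T\<close> gives uniqueness.\<close>

lemma polar_factor_invertible:
  "polar_factor T \<in> bounded_ops" "polar_factor T o\<^sub>L abs_op T = T"
proof -
  let ?P = "\<lambda>U. partial_isometry U \<and> T = U o\<^sub>L abs_op T \<and> kernel U = kernel T \<and>
    kernel T = kernel (abs_op T)"
  obtain V where V: "V \<in> bounded_ops" "V o\<^sub>L abs_op T = id_blinfun" "abs_op T o\<^sub>L V = id_blinfun"
    using invertible_abs_op unfolding invertible_op_def by blast
  have "\<exists>!U. ?P U"
  proof (rule ex1I)
    have "invertible_op V"
      using V strictly_positive_abs_op by (auto simp: invertible_op_def strictly_positive_op_def)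
    then have "invertible_op (T o\<^sub>L V)" using inv by (rule invertible_op_compose[rotated])
    moreover have "norm (T (V x)) = norm x" for x
      using norm_abs_op[of "V x"] V(3) by (simp add: left_inverse_apply)
    ultimately show "?P (T o\<^sub>L V)"
      using T V inv invertible_abs_op
      by (auto simp: partial_isometry_def compose_in_bounded_ops kernel_invertible_op
          blinfun_compose_assoc)
    show "U = T o\<^sub>L V" if "?P U" for U
      using that V(3) by (metis blinfun_compose_assoc blinfun_compose_id(1))
  qed
  from theI'[OF this] have "?P (polar_factor T)" unfolding polar_factor_def .
  then show "polar_factor T \<in> bounded_ops" "polar_factor T o\<^sub>L abs_op T = T"
    by (auto simp: partial_isometry_def)
qed

lemma aluthge_similar:
  obtains R S where "R \<in> bounded_ops" "S \<in> bounded_ops"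
    "R o\<^sub>L S = id_blinfun" "S o\<^sub>L R = id_blinfun" "aluthge T = R o\<^sub>L T o\<^sub>L S"
proof -
  define R where "R = sqrt_op (abs_op T)"
  have R: "R \<in> bounded_ops" "R o\<^sub>L R = abs_op T"
    using strictly_positive_sqrt_op[OF strictly_positive_abs_op]
      sqrt_op_square[OF strictly_positive_abs_op]
    by (auto simp: R_def strictly_positive_op_def)
  obtain S where S: "S \<in> bounded_ops" "S o\<^sub>L R = id_blinfun" "R o\<^sub>L S = id_blinfun"
    using invertible_sqrt_op[OF strictly_positive_abs_op invertible_abs_op]
    unfolding R_def invertible_op_def by blast
  \<comment> \<open>Inserting \<open>R S = I\<close> on the right completes
    \<open>R R = abs_op T\<close>, which the polar factor \<open>U\<close> absorbs through
    \<open>U R R = T\<close>.\<close>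
  have "aluthge T = R o\<^sub>L polar_factor T o\<^sub>L R o\<^sub>L (R o\<^sub>L S)"
    by (simp add: aluthge_def R_def[symmetric] S(3))
  also have "\<dots> = R o\<^sub>L (polar_factor T o\<^sub>L abs_op T) o\<^sub>L S"
    by (simp add: blinfun_compose_assoc flip: R(2))
  finally show ?thesis
    using that[OF R(1) S(1) S(3) S(2)] by (simp add: polar_factor_invertible)
qed

lemma aluthge_bounded_ops: "aluthge T \<in> bounded_ops"
  using aluthge_similar T by (metis compose_in_bounded_ops)

lemma invertible_aluthge: "invertible_op (aluthge T)"
  using aluthge_similar inv by (metis invertible_op_compose invertible_op_def)

text \<open>Undoing the similarity carries \<open>aluthge T - z\<close> to \<open>T - z\<close>,
  because the complex-linear \<open>S\<close> commutes with scalars; invertibility passes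
  along.\<close>

lemma spectrum_subset_aluthge: "spectrum T \<subseteq> spectrum (aluthge T)"
proof -
  obtain R S where RS: "R \<in> bounded_ops" "S \<in> bounded_ops"
    "R o\<^sub>L S = id_blinfun" "S o\<^sub>L R = id_blinfun" "aluthge T = R o\<^sub>L T o\<^sub>L S"
    by (rule aluthge_similar)
  have "invertible_op (T - scalar_op z)" if "invertible_op (aluthge T - scalar_op z)" for z
  proof -
    have "S (R x) = x" for x
      using RS(4) by (simp add: left_inverse_apply)
    then have "T - scalar_op z = S o\<^sub>L (aluthge T - scalar_op z) o\<^sub>L R"
      by (intro blinfun_eqI)
        (simp add: RS(5) blinfun.diff_left blinfun.diff_right scalar_op.rep_eq bounded_opsD[OF RS(2)])
    moreover have "invertible_op R" "invertible_op S"
      using RS unfolding invertible_op_def by blast+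
    ultimately show ?thesis
      using that by (simp add: invertible_op_compose)
  qed
  then show ?thesis by (auto simp: spectrum_def)
qed

end

section \<open>Iterating the transform and passing to the limit\<close>

text \<open>The induction carries complex linearity and invertibility along, since the results on a
  single transform assume both.\<close>

lemma aluthge_iterate:
  fixes T :: "'a :: chilbert_space \<Rightarrow>\<^sub>L 'a"
  assumes "T \<in> bounded_ops" "invertible_op T"
  shows "(aluthge ^^ n) T \<in> bounded_ops \<and> invertible_op ((aluthge ^^ n) T) \<and>
    spectrum T \<subseteq> spectrum ((aluthge ^^ n) T)"
proof (induction n)
  case (Suc n)
  then show ?case
    using aluthge_bounded_ops invertible_aluthge spectrum_subset_aluthge by fastforce
qed (use assms in simp)

theorem theorem2p6:
  fixes T L :: "'a :: chilbert_space \<Rightarrow>\<^sub>L 'a"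
  assumes "T \<in> bounded_ops" and "invertible_op T"
    and "L \<in> bounded_ops" and "invertible_op L" and "hyperbolic L"
    and "(\<lambda>n. (aluthge ^^ n) T) \<longlonglongrightarrow> L"
  shows "hyperbolic T"
proof -
  have "z \<notin> spectrum T" if z: "cmod z = 1" for z
  proof -
    let ?F = "\<lambda>n. (aluthge ^^ n) T - scalar_op z"
    have scal: "scalar_op z \<in> (bounded_ops :: ('a \<Rightarrow>\<^sub>L 'a) set)"
      by (simp add: bounded_ops_def scalar_op.rep_eq scaleC_scaleC mult.commute)
    have "invertible_op (L - scalar_op z)"
      using assms(5) z by (auto simp: hyperbolic_def spectrum_def)
    then have "\<exists>n. invertible_op (?F n)"
      using assms aluthge_iterate[OF assms(1,2)] scal
      by (intro invertible_op_of_limit[of ?F "L - scalar_op z"])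
        (auto intro!: tendsto_intros diff_in_bounded_ops)
    \<comment> \<open>Invertibility of one \<open>?F n\<close> puts \<open>z\<close> outside the
      spectrum of that iterate, which contains the spectrum of \<open>T\<close>.\<close>
    then show ?thesis
      using aluthge_iterate[OF assms(1,2)] by (auto simp: spectrum_def)
  qed
  then show ?thesis
    using assms(1,2) by (auto simp: hyperbolic_def)
qed

end
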